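(* For every graph $G$ and every $a \in \mathbb{N}$, $$f_a(G) \leq \bigl(P_\ell(G, \chi_\ell(G) + a - 1)\bigr)^a.$$
   Context: All graphs are finite, simple and nonempty; $\mathbb{N}=\{1,2,3,\dots\}$. A list assignment $L$ for a graph $G$ assigns to each vertex $v$ a set $L(v)$ of colors; a proper $L$-coloring is a proper coloring $c$ with $c(v)\in L(v)$ for all $v$. $L$ is a $k$-assignment if $|L(v)|=k$ for all $v$. The list chromatic number $\chi_\ell(G)$ is the least $k$ such that $G$ has a proper $L$-coloring for every $k$-assignment $L$. $P(G,L)$ denotes the number of proper $L$-colorings of $G$, and the list color function $P_\ell(G,k)$ is the minimum of $P(G,L)$ over all $k$-assignments $L$ for $G$. The Cartesian product $G \square H$ has vertex set $V(G)\times V(H)$, with $(u,v)$ adjacent to $(u',v')$ iff either $u=u'$ and $vv'\in E(H)$, or $v=v'$ and $uu'\in E(G)$. $K_{a,b}$ is the complete bipartite graph with parts of sizes $a$ and $b$. For $a\in\mathbb{N}$, $f_a(G)$ denotes the smallest $b \in \mathbb{N}$ such that $\chi_\ell(G \square K_{a,b}) = \chi_\ell(G) + a$ (such $b$ exists). *)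

theory Defs
  imports
    "HOL-Library.FuncSet"
    "Graph_Theory.Pair_Digraph"
    "Graph_Theory.Kuratowski"
begin

text \<open>
  Finite simple graphs are the pair graphs of the library: finite, loop-free digraphs with a
  symmetric arc set, where the edge \<open>uv\<close> is the pair of arcs \<open>(u, v)\<close> and \<open>(v, u)\<close>.
\<close>

definition proper_coloring :: "'v pair_pre_digraph \<Rightarrow> ('v \<Rightarrow> 'c) \<Rightarrow> bool" where
  "proper_coloring G c \<longleftrightarrow> (\<forall>(u, v) \<in> parcs G. c u \<noteq> c v)"

text \<open>
  Colorings are functions on the vertex set only: outside of it they take the fixed value
  \<^term>\<open>undefined\<close>, so that they can be counted.
\<close>

definition proper_list_colorings ::
    "'v pair_pre_digraph \<Rightarrow> ('v \<Rightarrow> 'c set) \<Rightarrow> ('v \<Rightarrow> 'c) set" where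
  "proper_list_colorings G L = {c \<in> Pi\<^sub>E (pverts G) L. proper_coloring G c}"

definition num_list_colorings :: "'v pair_pre_digraph \<Rightarrow> ('v \<Rightarrow> 'c set) \<Rightarrow> nat" where
  "num_list_colorings G L = card (proper_list_colorings G L)"

text \<open>Finiteness is required explicitly because \<^const>\<open>card\<close> is 0 on infinite sets.\<close>

definition k_assignment :: "'v pair_pre_digraph \<Rightarrow> nat \<Rightarrow> ('v \<Rightarrow> 'c set) \<Rightarrow> bool" where
  "k_assignment G k L \<longleftrightarrow> (\<forall>v \<in> pverts G. finite (L v) \<and> card (L v) = k)"

text \<open>
  In the next two definitions the colors are natural numbers. A k-assignment of a finite graph
  uses only finitely many colors, so this is no restriction.
\<close>

definition list_chromatic_number :: "'v pair_pre_digraph \<Rightarrow> nat" where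
  "list_chromatic_number G =
    (LEAST k. \<forall>L :: 'v \<Rightarrow> nat set. k_assignment G k L \<longrightarrow> proper_list_colorings G L \<noteq> {})"

definition list_color_function :: "'v pair_pre_digraph \<Rightarrow> nat \<Rightarrow> nat" where
  "list_color_function G k =
    (LEAST n. \<exists>L :: 'v \<Rightarrow> nat set. k_assignment G k L \<and> num_list_colorings G L = n)"

definition cartesian_product ::
    "'v pair_pre_digraph \<Rightarrow> 'w pair_pre_digraph \<Rightarrow> ('v \<times> 'w) pair_pre_digraph" where
  "cartesian_product G H =
    \<lparr> pverts = pverts G \<times> pverts H,
      parcs = {((u, v), (u', v')).
        u = u' \<and> u \<in> pverts G \<and> (v, v') \<in> parcs H \<or>
        v = v' \<and> v \<in> pverts H \<and> (u, u') \<in> parcs G} \<rparr>"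

definition complete_bipartite :: "nat \<Rightarrow> nat \<Rightarrow> (nat + nat) pair_pre_digraph" where
  "complete_bipartite a b =
    \<lparr> pverts = Inl ` {..<a} \<union> Inr ` {..<b},
      parcs = Inl ` {..<a} \<times> Inr ` {..<b} \<union> Inr ` {..<b} \<times> Inl ` {..<a} \<rparr>"

definition f_bip :: "nat \<Rightarrow> 'v pair_pre_digraph \<Rightarrow> nat" where
  "f_bip a G =
    (LEAST b. 1 \<le> b \<and>
      list_chromatic_number (cartesian_product G (complete_bipartite a b))
        = list_chromatic_number G + a)"

lemma complete_bipartite_digraph_complete_bipartite:
  "complete_bipartite_digraph a b (with_proj (complete_bipartite a b))"
  unfolding complete_bipartite_digraph_pair_def
proof (intro conjI exI)
  show "card (Inl ` {..<a} :: (nat + nat) set) = a" "card (Inr ` {..<b} :: (nat + nat) set) = b"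
    by (simp_all add: card_image)
qed (auto simp: complete_bipartite_def)

lemma pair_graph_complete_bipartite: "pair_graph (complete_bipartite a b)"
  using complete_bipartite_digraph_complete_bipartite by (rule pair_graphI_complete_bipartite)

lemma pair_graph_cartesian_product:
  assumes "pair_graph G" "pair_graph H"
  shows "pair_graph (cartesian_product G H)"
proof -
  interpret G: pair_graph G by fact
  interpret H: pair_graph H by fact
  let ?P = "cartesian_product G H"
  have sub: "parcs ?P \<subseteq> pverts ?P \<times> pverts ?P"
    by (auto simp: cartesian_product_def dest: G.in_arcsD1 G.in_arcsD2 H.in_arcsD1 H.in_arcsD2)
  have fin: "finite (pverts ?P)"
    by (simp add: cartesian_product_def G.pair_finite_verts H.pair_finite_verts)
  have sG: "sym (parcs G)" using G.pair_sym_arcs by (simp add: symmetric_def)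
  have sH: "sym (parcs H)" using H.pair_sym_arcs by (simp add: symmetric_def)
  have sym: "sym (parcs ?P)"
    by (rule symI) (auto simp: cartesian_product_def dest: symD[OF sG] symD[OF sH])
  show ?thesis
  proof unfold_locales
    show "finite (parcs ?P)" using sub fin by (meson finite_SigmaI finite_subset)
    show "fst e \<noteq> snd e" if "e \<in> parcs ?P" for e
      using that by (auto simp: cartesian_product_def dest: G.pair_no_loops H.pair_no_loops)
  qed (use sub fin sym in \<open>auto simp: symmetric_def\<close>)
qed

end

theory Submission
  imports Defs
begin

text \<open>
  Write \<open>m = \<chi>\<^sub>\<ell>(G)\<close> and \<open>k = m + a - 1\<close>. Coloring the \<open>a\<close> copies of \<open>G\<close> on the left removes at
  most \<open>a\<close> colors from each list on the right, so lists of size \<open>m + a\<close> always suffice. For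
  \<open>b = P\<^sub>\<ell>(G, k)\<^sup>a\<close> lists of size \<open>k\<close> do not: put color-disjoint copies of a \<open>k\<close>-assignment with
  the fewest colorings on the left copies, so that the left side has exactly \<open>b\<close> colorings, and
  let each right copy defeat one of them. Its lists consist of the \<open>a\<close> colors used by that
  coloring above the vertex, together with a fresh \<open>(m - 1)\<close>-assignment without proper coloring.
\<close>

section \<open>Choosability and its monotonicity in the list size\<close>

definition choosable :: "'v pair_pre_digraph \<Rightarrow> nat \<Rightarrow> bool" where
  "choosable G k \<longleftrightarrow>
    (\<forall>L :: 'v \<Rightarrow> nat set. k_assignment G k L \<longrightarrow> proper_list_colorings G L \<noteq> {})"

lemma list_chromatic_number_eq_Least_choosable:
  "list_chromatic_number G = (LEAST k. choosable G k)"
  by (simp add: list_chromatic_number_def choosable_def)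

text \<open>Shrinking every list to a subset of size \<open>k\<close> only removes colorings. This
  form is needed because deleting used colors leaves lists of varying size, and it also yields
  monotonicity in \<open>k\<close>.\<close>

lemma choosable_large_lists:
  fixes L :: "'v \<Rightarrow> nat set"
  assumes "choosable G k" and "\<And>v. v \<in> pverts G \<Longrightarrow> k \<le> card (L v)"
    and "\<And>v. v \<in> pverts G \<Longrightarrow> finite (L v)"
  shows "proper_list_colorings G L \<noteq> {}"
proof -
  have "\<forall>v \<in> pverts G. \<exists>T. T \<subseteq> L v \<and> finite T \<and> card T = k"
    using assms(2) obtain_subset_with_card_n by metis
  then obtain L' where L': "\<forall>v \<in> pverts G. L' v \<subseteq> L v \<and> finite (L' v) \<and> card (L' v) = k"
    by metis
  then have "proper_list_colorings G L' \<noteq> {}"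
    using assms(1) unfolding choosable_def k_assignment_def by blast
  then obtain c where "c \<in> proper_list_colorings G L'" by blast
  then have "c \<in> proper_list_colorings G L"
    using L' unfolding proper_list_colorings_def by (auto simp: PiE_iff)
  then show ?thesis by blast
qed

lemma choosable_mono: "choosable G k \<Longrightarrow> k \<le> k' \<Longrightarrow> choosable G k'"
  using choosable_large_lists[of G k] unfolding choosable_def[of G k'] k_assignment_def by metis

text \<open>By monotonicity, failure at \<open>k\<close> alone rules out every smaller list
  size.\<close>

lemma list_chromatic_number_eqI:
  assumes "choosable G (Suc k)" and "\<not> choosable G k"
  shows "list_chromatic_number G = Suc k"
  unfolding list_chromatic_number_eq_Least_choosable
proof (rule Least_equality)
  show "Suc k \<le> j" if "choosable G j" for j
    using that assms(2) choosable_mono not_less_eq_eq by blast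
qed fact

text \<open>Greedy choice: the colors already used are fewer than the colors in the next list, so
  one of the latter is new.\<close>

lemma ex_inj_choice:
  assumes "finite S" and "\<And>v. v \<in> S \<Longrightarrow> finite (L v) \<and> card S \<le> card (L v)"
  shows "\<exists>c. inj_on c S \<and> (\<forall>v \<in> S. c v \<in> L v)"
  using assms
proof (induction S rule: finite_induct)
  case empty
  show ?case by simp
next
  case (insert x S)
  then have "finite (L v) \<and> card S \<le> card (L v)" if "v \<in> S" for v
    using that by (simp add: Suc_leD)
  then obtain c where c: "inj_on c S" "\<forall>v \<in> S. c v \<in> L v"
    using insert.IH by blast
  have "card (c ` S) < card (L x)"
    using insert.prems[of x] insert.hyps c(1) by (simp add: card_image)
  then have "\<not> L x \<subseteq> c ` S"
    using card_mono insert.hyps(1) leD by blast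
  then obtain y where "y \<in> L x" "y \<notin> c ` S" by blast
  then have "inj_on (c(x := y)) (insert x S) \<and> (\<forall>v \<in> insert x S. (c(x := y)) v \<in> L v)"
    using c insert.hyps by (auto simp: inj_on_def)
  then show ?case by blast
qed

text \<open>Lists this long allow pairwise distinct colors on all vertices. This supplies the
  witness that makes the \<open>LEAST\<close> in the list chromatic number attained.\<close>

lemma choosable_card_verts:
  assumes "pair_graph G"
  shows "choosable G (card (pverts G))"
  unfolding choosable_def
proof (intro allI impI)
  interpret pair_graph G by fact
  fix L :: "'a \<Rightarrow> nat set"
  assume "k_assignment G (card (pverts G)) L"
  then obtain c where c: "inj_on c (pverts G)" "\<forall>v \<in> pverts G. c v \<in> L v"
    using ex_inj_choice[OF pair_finite_verts, of L] unfolding k_assignment_def by auto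
  have "c u \<noteq> c v" if "(u, v) \<in> parcs G" for u v
    using that c(1) in_arcsD1 in_arcsD2 pair_no_loops by (fastforce simp: inj_on_eq_iff)
  then have "restrict c (pverts G) \<in> proper_list_colorings G L"
    using c(2) in_arcsD1 in_arcsD2
    by (fastforce simp: proper_list_colorings_def proper_coloring_def)
  then show "proper_list_colorings G L \<noteq> {}" by blast
qed

lemma choosable_list_chromatic_number:
  "pair_graph G \<Longrightarrow> choosable G (list_chromatic_number G)"
  unfolding list_chromatic_number_eq_Least_choosable
  by (rule LeastI) (rule choosable_card_verts)

lemma not_choosable_less_list_chromatic_number:
  "k < list_chromatic_number G \<Longrightarrow> \<not> choosable G k"
  unfolding list_chromatic_number_eq_Least_choosable by (rule not_less_Least)

lemma list_chromatic_number_pos: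
  assumes "pair_graph G" and "pverts G \<noteq> {}"
  shows "0 < list_chromatic_number G"
proof (rule ccontr)
  assume "\<not> 0 < list_chromatic_number G"
  then have "choosable G 0"
    using choosable_list_chromatic_number[OF assms(1)] by simp
  moreover have "k_assignment G 0 (\<lambda>_. {} :: nat set)"
    by (simp add: k_assignment_def)
  moreover have "proper_list_colorings G (\<lambda>_. {} :: nat set) = {}"
    using assms(2) by (auto simp: proper_list_colorings_def PiE_iff)
  ultimately show False unfolding choosable_def by metis
qed

section \<open>Counting list colorings\<close>

lemma finite_proper_list_colorings:
  "finite (pverts G) \<Longrightarrow> k_assignment G k L \<Longrightarrow> finite (proper_list_colorings G L)"
  unfolding proper_list_colorings_def k_assignment_def
  by (rule finite_subset[of _ "Pi\<^sub>E (pverts G) L"]) (auto intro: finite_PiE)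

text \<open>The constant assignment shows that the minimum ranges over a nonempty set.\<close>

lemma list_color_function_attained:
  obtains L :: "'v \<Rightarrow> nat set"
  where "k_assignment G k L" "num_list_colorings G L = list_color_function G k"
proof -
  have "k_assignment G k (\<lambda>_. {..<k})"
    by (simp add: k_assignment_def)
  then have "\<exists>n. \<exists>L :: 'v \<Rightarrow> nat set. k_assignment G k L \<and> num_list_colorings G L = n"
    by blast
  then have "\<exists>L :: 'v \<Rightarrow> nat set. k_assignment G k L \<and>
      num_list_colorings G L = list_color_function G k"
    unfolding list_color_function_def by (rule LeastI_ex)
  then show ?thesis using that by blast
qed

lemma list_color_function_pos:
  assumes "pair_graph G" and "list_chromatic_number G \<le> k"
  shows "0 < list_color_function G k"
proof -
  interpret pair_graph G by fact
  obtain L :: "'a \<Rightarrow> nat set"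
    where L: "k_assignment G k L" "num_list_colorings G L = list_color_function G k"
    by (rule list_color_function_attained)
  have "choosable G k"
    using choosable_mono[OF choosable_list_chromatic_number] assms by blast
  then have "proper_list_colorings G L \<noteq> {}"
    using L(1) by (auto simp: choosable_def)
  then show ?thesis
    using L finite_proper_list_colorings[OF pair_finite_verts L(1)]
    by (simp add: num_list_colorings_def card_gt_0_iff flip: L(2))
qed

section \<open>Products with complete bipartite graphs\<close>

lemma choosable_cartesian_product_complete_bipartite:
  assumes "pair_graph G" and "choosable G m"
  shows "choosable (cartesian_product G (complete_bipartite a b)) (m + a)"
  unfolding choosable_def
proof (intro allI impI)
  let ?P = "cartesian_product G (complete_bipartite a b)"
  interpret pair_graph G by fact
  fix L :: "'a \<times> (nat + nat) \<Rightarrow> nat set"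
  assume L: "k_assignment ?P (m + a) L"
  have L1: "finite (L (v, Inl i)) \<and> card (L (v, Inl i)) = m + a" if "v \<in> pverts G" "i < a" for v i
    using that L
    by (auto simp: k_assignment_def cartesian_product_def complete_bipartite_def)
  have L2: "finite (L (v, Inr j)) \<and> card (L (v, Inr j)) = m + a" if "v \<in> pverts G" "j < b" for v j
    using that L
    by (auto simp: k_assignment_def cartesian_product_def complete_bipartite_def)
  have "\<exists>c. c \<in> proper_list_colorings G (\<lambda>v. L (v, Inl i))" if "i < a" for i
    using choosable_large_lists[OF assms(2), of "\<lambda>v. L (v, Inl i)"] L1 that by fastforce
  then obtain l where l: "\<And>i. i < a \<Longrightarrow> l i \<in> proper_list_colorings G (\<lambda>v. L (v, Inl i))"
    by metis
  \<comment> \<open>The right copies are pairwise nonadjacent, so each is colored on its own. At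
    each vertex it must avoid one color per left copy; these may coincide, so at least
    \<open>m\<close> colors remain.\<close>
  have "\<exists>c. c \<in> proper_list_colorings G (\<lambda>v. L (v, Inr j) - (\<lambda>i. l i v) ` {..<a})"
    if "j < b" for j
  proof -
    have "m \<le> card (L (v, Inr j) - (\<lambda>i. l i v) ` {..<a})" if "v \<in> pverts G" for v
    proof -
      have "card ((\<lambda>i. l i v) ` {..<a}) \<le> a"
        using card_image_le[of "{..<a}"] by simp
      then show ?thesis
        using diff_card_le_card_Diff[of "(\<lambda>i. l i v) ` {..<a}" "L (v, Inr j)"]
          L2[OF that \<open>j < b\<close>] by simp
    qed
    then have "proper_list_colorings G (\<lambda>v. L (v, Inr j) - (\<lambda>i. l i v) ` {..<a}) \<noteq> {}"
      using L2 \<open>j < b\<close> by (intro choosable_large_lists[OF assms(2)]) auto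
    then show ?thesis by blast
  qed
  then obtain r where
    r: "\<And>j. j < b \<Longrightarrow> r j \<in> proper_list_colorings G (\<lambda>v. L (v, Inr j) - (\<lambda>i. l i v) ` {..<a})"
    by metis
  define c where "c = restrict (\<lambda>(v, x). case x of Inl i \<Rightarrow> l i v | Inr j \<Rightarrow> r j v) (pverts ?P)"
  have cl: "c (v, Inl i) = l i v" if "v \<in> pverts G" "i < a" for v i
    using that by (simp add: c_def cartesian_product_def complete_bipartite_def)
  have cr: "c (v, Inr j) = r j v" if "v \<in> pverts G" "j < b" for v j
    using that by (simp add: c_def cartesian_product_def complete_bipartite_def)
  have "c \<in> Pi\<^sub>E (pverts ?P) L"
  proof (rule PiE_I)
    show "c p \<in> L p" if "p \<in> pverts ?P" for p
      using that cl cr l r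
      by (fastforce simp: cartesian_product_def complete_bipartite_def proper_list_colorings_def
          PiE_iff)
  qed (simp add: c_def)
  moreover have "proper_coloring ?P c"
  proof -
    have lr: "l i v \<noteq> r j v" if "i < a" "j < b" "v \<in> pverts G" for i j v
    proof -
      have "r j v \<notin> (\<lambda>i. l i v) ` {..<a}"
        using r[OF that(2)] that(3) by (simp add: proper_list_colorings_def PiE_iff)
      then show ?thesis using that(1) by (metis (mono_tags) image_eqI lessThan_iff)
    qed
    have ll: "c (u, Inl i) \<noteq> c (v, Inl i)" if "(u, v) \<in> parcs G" "i < a" for i u v
      using l[OF that(2)] that cl in_arcsD1[OF that(1)] in_arcsD2[OF that(1)]
      by (auto simp: proper_list_colorings_def proper_coloring_def)
    have rr: "c (u, Inr j) \<noteq> c (v, Inr j)" if "(u, v) \<in> parcs G" "j < b" for j u v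
      using r[OF that(2)] that cr in_arcsD1[OF that(1)] in_arcsD2[OF that(1)]
      by (auto simp: proper_list_colorings_def proper_coloring_def)
    show ?thesis
      using lr lr[symmetric] ll rr
      by (auto simp: proper_coloring_def cartesian_product_def complete_bipartite_def cl cr)
  qed
  ultimately show "proper_list_colorings ?P L \<noteq> {}"
    by (auto simp: proper_list_colorings_def)
qed

text \<open>This will be applied with \<open>m\<close> one less than the list chromatic number of
  \<open>G\<close>, so that \<open>m + a\<close> is the list size at which the list color function
  is evaluated.\<close>

lemma not_choosable_cartesian_product_complete_bipartite:
  assumes "pair_graph G" and "\<not> choosable G m"
  shows "\<not> choosable (cartesian_product G (complete_bipartite a (list_color_function G (m + a) ^ a)))
    (m + a)"
proof
  let ?k = "m + a"
  let ?b = "list_color_function G ?k ^ a"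
  let ?P = "cartesian_product G (complete_bipartite a ?b)"
  interpret pair_graph G by fact
  assume choosable: "choosable ?P ?k"
  obtain B :: "'a \<Rightarrow> nat set" where B: "k_assignment G m B" "proper_list_colorings G B = {}"
    using assms(2) unfolding choosable_def by blast
  obtain L :: "'a \<Rightarrow> nat set"
    where L: "k_assignment G ?k L" "num_list_colorings G L = list_color_function G ?k"
    by (rule list_color_function_attained)
  \<comment> \<open>\<open>?T\<close> holds the possible colorings of the whole left side, up to
    tags: one coloring from \<open>L\<close> per left copy. There are exactly \<open>?b\<close> of
    them, so \<open>t\<close> can give each one its own right copy.\<close>
  let ?T = "{..<a} \<rightarrow>\<^sub>E proper_list_colorings G L"
  have "finite ?T"
    using finite_proper_list_colorings[OF pair_finite_verts L(1)] by (intro finite_PiE) auto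
  moreover have "card ?T = ?b"
    using L(2) by (simp add: card_PiE num_list_colorings_def)
  ultimately obtain t where t: "bij_betw t {..<?b} ?T"
    using ex_bij_betw_nat_finite by (metis atLeast0LessThan)
  \<comment> \<open>Tags \<open>i < a\<close> mark the colors of the left copy \<open>i\<close>, and the tag \<open>a\<close> those of \<open>B\<close>.\<close>
  define M where "M = (\<lambda>(v, x). case x of
      Inl i \<Rightarrow> (\<lambda>c. prod_encode (i, c)) ` L v
    | Inr j \<Rightarrow> (\<lambda>i. prod_encode (i, t j i v)) ` {..<a} \<union> (\<lambda>c. prod_encode (a, c)) ` B v)"
  have Ml: "M (v, Inl i) = (\<lambda>c. prod_encode (i, c)) ` L v" for v i
    by (simp add: M_def)
  have Mr: "M (v, Inr j) =
      (\<lambda>i. prod_encode (i, t j i v)) ` {..<a} \<union> (\<lambda>c. prod_encode (a, c)) ` B v" for v j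
    by (simp add: M_def)
  have "finite (M (v, Inl i)) \<and> card (M (v, Inl i)) = ?k" if "v \<in> pverts G" for v i
    using L(1) that by (auto simp: Ml k_assignment_def card_image inj_on_def)
  moreover have "finite (M (v, Inr j)) \<and> card (M (v, Inr j)) = ?k" if "v \<in> pverts G" for v j
  proof -
    have "finite (B v)" "card (B v) = m"
      using B(1) that by (auto simp: k_assignment_def)
    \<comment> \<open>The tags keep these \<open>a\<close> colors distinct even if the values
      \<open>t j i v\<close> coincide, so the list has exactly \<open>m + a\<close>
      elements.\<close>
    moreover have "card ((\<lambda>i. prod_encode (i, t j i v)) ` {..<a}) = a"
      by (subst card_image) (auto simp: inj_on_def)
    moreover have "card ((\<lambda>c. prod_encode (a, c)) ` B v) = card (B v)"
      by (rule card_image) (auto simp: inj_on_def)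
    moreover have "(\<lambda>i. prod_encode (i, t j i v)) ` {..<a} \<inter> (\<lambda>c. prod_encode (a, c)) ` B v = {}"
      by auto
    ultimately show ?thesis
      unfolding Mr by (subst card_Un_disjoint) auto
  qed
  ultimately have "k_assignment ?P ?k M"
    by (auto simp: k_assignment_def cartesian_product_def complete_bipartite_def)
  then obtain c where c: "c \<in> proper_list_colorings ?P M"
    using choosable unfolding choosable_def by blast
  have c_in_l: "c (v, Inl i) \<in> M (v, Inl i)" if "v \<in> pverts G" "i < a" for v i
    using c that
    by (auto simp: proper_list_colorings_def PiE_iff cartesian_product_def complete_bipartite_def)
  have c_in_r: "c (v, Inr j) \<in> M (v, Inr j)" if "v \<in> pverts G" "j < ?b" for v j
    using c that
    by (auto simp: proper_list_colorings_def PiE_iff cartesian_product_def complete_bipartite_def)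
  have c_neq: "c p \<noteq> c q" if "(p, q) \<in> parcs ?P" for p q
    using c that by (auto simp: proper_list_colorings_def proper_coloring_def)
  \<comment> \<open>\<open>s\<close> is the left side of \<open>c\<close> with the tags stripped.
    Both restrictions make it extensional, so that it is literally an element of
    \<open>?T\<close>.\<close>
  define s where "s = (\<lambda>i\<in>{..<a}. \<lambda>v\<in>pverts G. snd (prod_decode (c (v, Inl i))))"
  have c_s: "c (v, Inl i) = prod_encode (i, s i v)" "s i v \<in> L v" if "v \<in> pverts G" "i < a" for v i
    using c_in_l[OF that] that by (auto simp: Ml s_def)
  have "s i \<in> proper_list_colorings G L" if "i < a" for i
  proof -
    have "s i u \<noteq> s i v" if uv: "(u, v) \<in> parcs G" for u v
    proof
      assume "s i u = s i v"
      moreover have "u \<in> pverts G" "v \<in> pverts G"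
        using in_arcsD1 in_arcsD2 uv by auto
      ultimately have "c (u, Inl i) = c (v, Inl i)"
        using c_s \<open>i < a\<close> by simp
      then show False
        using c_neq[of "(u, Inl i)" "(v, Inl i)"] uv \<open>i < a\<close>
        by (simp add: cartesian_product_def complete_bipartite_def)
    qed
    moreover have "s i \<in> Pi\<^sub>E (pverts G) L"
      using c_s(2) \<open>i < a\<close> by (auto simp: PiE_iff) (simp add: s_def)
    ultimately show ?thesis
      by (auto simp: proper_list_colorings_def proper_coloring_def)
  qed
  then have "s \<in> ?T"
    by (auto simp: PiE_iff s_def)
  then have "s \<in> t ` {..<?b}"
    using t by (simp add: bij_betw_imp_surj_on)
  \<comment> \<open>The right copy \<open>j\<close> was built to defeat exactly the left coloring
    \<open>s\<close>.\<close>
  then obtain j where j: "j < ?b" "t j = s" by auto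
  define d where "d = (\<lambda>v\<in>pverts G. snd (prod_decode (c (v, Inr j))))"
  \<comment> \<open>Each of the \<open>a\<close> colors copied from the left side is already used by
    a neighbor of \<open>(v, Inr j)\<close>, so only the colors tagged \<open>a\<close> remain.
    Hence \<open>d\<close> will be a proper coloring from \<open>B\<close>, which has none.\<close>
  have c_d: "c (v, Inr j) = prod_encode (a, d v) \<and> d v \<in> B v" if v: "v \<in> pverts G" for v
  proof -
    have "c (v, Inr j) \<noteq> prod_encode (i, t j i v)" if "i < a" for i
      using c_neq[of "(v, Inl i)" "(v, Inr j)"] v that j c_s(1)[OF v that]
      by (auto simp: cartesian_product_def complete_bipartite_def)
    then have "c (v, Inr j) \<in> (\<lambda>c. prod_encode (a, c)) ` B v"
      using c_in_r[OF v j(1)] unfolding Mr by blast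
    then show ?thesis
      using v by (auto simp: d_def)
  qed
  have "d u \<noteq> d v" if uv: "(u, v) \<in> parcs G" for u v
  proof
    assume "d u = d v"
    moreover have "u \<in> pverts G" "v \<in> pverts G"
      using in_arcsD1 in_arcsD2 uv by auto
    ultimately have "c (u, Inr j) = c (v, Inr j)"
      using c_d by simp
    then show False
      using c_neq[of "(u, Inr j)" "(v, Inr j)"] uv j(1)
      by (simp add: cartesian_product_def complete_bipartite_def)
  qed
  moreover have "d \<in> Pi\<^sub>E (pverts G) B"
    using c_d by (auto simp: PiE_iff) (simp add: d_def)
  ultimately have "d \<in> proper_list_colorings G B"
    by (auto simp: proper_list_colorings_def proper_coloring_def)
  then show False using B(2) by blast
qed

theorem theorem1p5:
  fixes G :: "'v pair_pre_digraph" and a :: nat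
  assumes "pair_graph G" and "pverts G \<noteq> {}" and "1 \<le> a"
  shows "f_bip a G \<le> list_color_function G (list_chromatic_number G + a - 1) ^ a"
proof -
  \<comment> \<open>Positivity gives a list size \<open>m\<close> just below the list chromatic
    number, at which choosability fails, and turns the subtraction in the claim into
    \<open>m + a\<close>.\<close>
  obtain m where m: "list_chromatic_number G = Suc m"
    using list_chromatic_number_pos[OF assms(1,2)] gr0_implies_Suc by blast
  let ?b = "list_color_function G (m + a) ^ a"
  let ?P = "cartesian_product G (complete_bipartite a ?b)"
  have "choosable ?P (Suc (m + a))"
    using choosable_cartesian_product_complete_bipartite[OF assms(1)
        choosable_list_chromatic_number[OF assms(1)]] m by simp
  moreover have "\<not> choosable ?P (m + a)"
    using m by (intro not_choosable_cartesian_product_complete_bipartite[OF assms(1)]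
        not_choosable_less_list_chromatic_number) simp
  ultimately have "list_chromatic_number ?P = list_chromatic_number G + a"
    using list_chromatic_number_eqI m by simp
  \<comment> \<open>The minimum in \<open>f_bip\<close> ranges over positive numbers only.\<close>
  moreover have "1 \<le> ?b"
    using list_color_function_pos[OF assms(1), of "m + a"] m assms(3) by simp
  ultimately have "f_bip a G \<le> ?b"
    unfolding f_bip_def by (intro Least_le) simp
  then show ?thesis
    using m by simp
qed

end
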